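(* Let $G$ be a finite simple graph with no isolated vertices and let $b$ be an integer. Then $G$ is a disconnected quasi $f$-graph of type $(0,b)$ if and only if $G$ is an $[m:n]$-graph for some positive integers $m,n$ with $(m-n)^2=m+n-2b$.
   Context: For positive integers $m,n$, a graph $G$ is an $[m:n]$-graph if its complementary graph $\overline{G}$ is the complete bipartite graph $K_{m,n}$ on $m+n$ vertices; equivalently $G$ is the disjoint union $K_m\sqcup K_n$ of complete graphs. A graph is connected/disconnected in the usual sense (equivalently, as a $1$-dimensional simplicial complex, any two edges are linked by a chain of edges with consecutive ones sharing a vertex). Let $G$ have vertex set $V=\{v_1,\dots,v_N\}$, $k$ a field, $R=k[x_1,\dots,x_N]$, $x_F=\prod_{v_i\in F}x_i$. For a square-free monomial ideal $I\subseteq R$ with minimal generating set $G(I)$: the facet complex $\delta_{\mathcal F}(I)$ is the simplicial complex whose facets are the sets $\{v_{i_1},\dots,v_{i_r}\}$ with $x_{i_1}\cdots x_{i_r}\in G(I)$; the non-face complex $\delta_{\mathcal N}(I)$ is $\{F\subseteq V: x_F\notin I\}$. The $f$-vector of a $d$-dimensional complex is $(f_0,\dots,f_d)$, $f_i$ the number of faces with $i+1$ elements. $I$ is a quasi $f$-ideal of type $(a_1,\dots,a_s)\in\mathbb Z^s$ if $f(\delta_{\mathcal N}(I))-f(\delta_{\mathcal F}(I))=(a_1,\dots,a_s)$, both $f$-vectors lying in $\mathbb Z^s$. $G$ is a quasi $f$-graph of type $(0,b)$ if its edge ideal $I(G)=(x_ix_j:\{v_i,v_j\}\in E(G))$ is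 a quasi $f$-ideal of type $(0,b)$. *)

theory Defs
  imports
    "HOL-Library.Poly_Mapping"
    "HOL-Algebra.Ideal"
    "Graph_Theory.Graph_Theory"
begin

section \<open>Square-free monomial ideals of $k[x_v : v \in V]$\<close>

text \<open>
  A polynomial is a finitely supported function from exponent vectors to coefficients.
  The ring of polynomials in the variables indexed by the (finite) set \<open>V\<close> is the subring of
  those polynomials in whose monomials only variables from \<open>V\<close> occur.
\<close>

type_synonym ('v, 'k) mpoly = "('v \<Rightarrow>\<^sub>0 nat) \<Rightarrow>\<^sub>0 'k"

definition poly_ring_on :: "'v set \<Rightarrow> ('v, 'k::field) mpoly ring" where
  "poly_ring_on V =
     \<lparr>carrier = {p. \<forall>e\<in>Poly_Mapping.keys p. Poly_Mapping.keys e \<subseteq> V},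
      monoid.mult = (*), one = 1, zero = 0, add = (+)\<rparr>"

lemma poly_ring_on_cring: "cring (poly_ring_on V :: ('v, 'k::field) mpoly ring)"
proof -
  let ?R = "poly_ring_on V :: ('v, 'k) mpoly ring"
  have add: "p + q \<in> carrier ?R" if "p \<in> carrier ?R" "q \<in> carrier ?R" for p q
    using that Poly_Mapping.keys_add[of p q] by (auto simp: poly_ring_on_def)
  have uminus: "- p \<in> carrier ?R" if "p \<in> carrier ?R" for p
    using that by (auto simp: poly_ring_on_def)
  have mult: "p * q \<in> carrier ?R" if "p \<in> carrier ?R" "q \<in> carrier ?R" for p q
  proof -
    have "Poly_Mapping.keys e \<subseteq> V" if e: "e \<in> Poly_Mapping.keys (p * q)" for e
    proof -
      obtain a b where ab: "a \<in> Poly_Mapping.keys p" "b \<in> Poly_Mapping.keys q" "e = a + b"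
        using e Poly_Mapping.keys_mult[of p q] by blast
      then have "Poly_Mapping.keys a \<subseteq> V" "Poly_Mapping.keys b \<subseteq> V"
        using \<open>p \<in> carrier ?R\<close> \<open>q \<in> carrier ?R\<close> by (auto simp: poly_ring_on_def)
      then show ?thesis
        using Poly_Mapping.keys_add[of a b] ab(3) by blast
    qed
    then show ?thesis by (simp add: poly_ring_on_def)
  qed
  have sel: "monoid.mult ?R = (*)" "add ?R = (+)" "one ?R = 1" "zero ?R = 0"
    by (simp_all add: poly_ring_on_def)
  have zero: "0 \<in> carrier ?R" and one: "1 \<in> carrier ?R"
    by (simp_all add: poly_ring_on_def)
  have "abelian_group ?R"
  proof (rule abelian_groupI, unfold sel)
    fix p assume "p \<in> carrier ?R"
    then show "\<exists>q\<in>carrier ?R. q + p = 0"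
      using uminus by (intro bexI[of _ "- p"]) simp_all
  qed (simp_all add: add zero add.assoc add.commute)
  moreover have "Group.comm_monoid ?R"
    by (rule Group.comm_monoidI, unfold sel) (simp_all add: mult one mult.assoc mult.commute)
  ultimately show ?thesis
    by (rule cringI, unfold sel) (simp add: distrib_right)
qed

definition monomials_on :: "'v set \<Rightarrow> ('v, 'k::field) mpoly set" where
  "monomials_on V = {Poly_Mapping.single e 1 | e. Poly_Mapping.keys e \<subseteq> V}"

definition var :: "'v \<Rightarrow> ('v, 'k::field) mpoly" where
  "var v = Poly_Mapping.single (Poly_Mapping.single v 1) 1"

definition sqfree_monomial :: "'v set \<Rightarrow> ('v, 'k::field) mpoly" where
  "sqfree_monomial F = (\<Prod>v\<in>F. var v)"

definition sqfree_monomial_ideal :: "'v set \<Rightarrow> ('v, 'k::field) mpoly set \<Rightarrow> bool" where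
  "sqfree_monomial_ideal V I \<longleftrightarrow>
     (\<exists>\<F>. \<F> \<subseteq> Pow V \<and> I = Idl\<^bsub>poly_ring_on V\<^esub> (sqfree_monomial ` \<F>))"

text \<open>
  $G(I)$: a monomial ideal has exactly one irredundant generating set consisting of monomials.
\<close>

definition min_monomial_gens :: "'v set \<Rightarrow> ('v, 'k::field) mpoly set \<Rightarrow> ('v, 'k) mpoly set" where
  "min_monomial_gens V I =
     (THE S. S \<subseteq> monomials_on V \<and> Idl\<^bsub>poly_ring_on V\<^esub> S = I \<and>
             (\<forall>T. T \<subset> S \<longrightarrow> Idl\<^bsub>poly_ring_on V\<^esub> T \<noteq> I))"


section \<open>Facet complex, non-face complex, and quasi f-ideals\<close>

text \<open>
  Abstract simplicial complexes are downward closed sets of finite sets, the empty face included;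
  the complex without facets is the void complex \<open>{}\<close>.
\<close>

definition facet_complex :: "'v set \<Rightarrow> ('v, 'k::field) mpoly set \<Rightarrow> 'v set set" where
  "facet_complex V I =
     {A. \<exists>F. F \<subseteq> V \<and> sqfree_monomial F \<in> min_monomial_gens V I \<and> A \<subseteq> F}"

definition nonface_complex :: "'v set \<Rightarrow> ('v, 'k::field) mpoly set \<Rightarrow> 'v set set" where
  "nonface_complex V I = {F. F \<subseteq> V \<and> sqfree_monomial F \<notin> I}"

text \<open>
  The dimension of a finite complex is one less than the largest number of vertices of a face.
  By convention the void complex has dimension $-1$, so that, like that of \<open>{{}}\<close>,
  its f-vector is empty.
\<close>

definition complex_dim :: "'v set set \<Rightarrow> int" where
  "complex_dim \<Delta> = (if \<Delta> = {} then - 1 else int (Max (card ` \<Delta>)) - 1)"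

definition f_vector :: "'v set set \<Rightarrow> int list" where
  "f_vector \<Delta> = map (\<lambda>i. int (card {F \<in> \<Delta>. card F = i + 1})) [0..<nat (complex_dim \<Delta> + 1)]"

definition quasi_f_ideal :: "'v set \<Rightarrow> ('v, 'k::field) mpoly set \<Rightarrow> int list \<Rightarrow> bool" where
  "quasi_f_ideal V I as \<longleftrightarrow>
     sqfree_monomial_ideal V I \<and>
     length (f_vector (nonface_complex V I)) = length as \<and>
     length (f_vector (facet_complex V I)) = length as \<and>
     map2 (-) (f_vector (nonface_complex V I)) (f_vector (facet_complex V I)) = as"


section \<open>Quasi f-graphs and [m:n]-graphs\<close>

text \<open>
  A finite simple graph is a \<^locale>\<open>pair_graph\<close>: a finite loop-free digraph with a symmetric
  set of arcs, an edge being represented by its two opposite arcs.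
\<close>

definition edge_ideal :: "'v pair_pre_digraph \<Rightarrow> ('v, 'k::field) mpoly set" where
  "edge_ideal G = Idl\<^bsub>poly_ring_on (pverts G)\<^esub> {var u * var v | u v. (u, v) \<in> parcs G}"

definition quasi_f_graph :: "'k::field itself \<Rightarrow> 'v pair_pre_digraph \<Rightarrow> int list \<Rightarrow> bool" where
  "quasi_f_graph k G as \<longleftrightarrow>
     quasi_f_ideal (pverts G) (edge_ideal G :: ('v, 'k) mpoly set) as"

definition no_isolated_vertices :: "'v pair_pre_digraph \<Rightarrow> bool" where
  "no_isolated_vertices G \<longleftrightarrow> (\<forall>v\<in>pverts G. \<exists>w. (v, w) \<in> parcs G)"

definition complement_graph :: "'v pair_pre_digraph \<Rightarrow> 'v pair_pre_digraph" where
  "complement_graph G =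
     \<lparr>pverts = pverts G,
      parcs = {(u, v). u \<in> pverts G \<and> v \<in> pverts G \<and> u \<noteq> v \<and> (u, v) \<notin> parcs G}\<rparr>"

definition mn_graph :: "nat \<Rightarrow> nat \<Rightarrow> 'v pair_pre_digraph \<Rightarrow> bool" where
  "mn_graph m n G \<longleftrightarrow>
     m > 0 \<and> n > 0 \<and> complete_bipartite_digraph m n (with_proj (complement_graph G))"

end

theory Submission
  imports Defs
begin

text \<open>
  Membership of a monomial in a monomial ideal is divisibility by a generator, so the edges are the
  minimal generators of the edge ideal: the facet complex is \<open>G\<close> itself and the non-face complex
  consists of the independent sets. Without isolated vertices the first entries of the two f-vectors
  agree, so being of type $(0, b)$ means that there is a non-edge, no independent set has three
  elements, and $b$ is the number of non-edges minus the number of edges. If $G$ is disconnected,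
  two non-adjacent vertices of one component together with a vertex outside would form an
  independent triple, hence $G$ is $K_m \sqcup K_n$, with $mn$ non-edges.
\<close>

section \<open>Monomial ideals\<close>

abbreviation mono_poly :: "('v \<Rightarrow>\<^sub>0 nat) \<Rightarrow> ('v, 'k::field) mpoly" where
  "mono_poly e \<equiv> Poly_Mapping.single e 1"

lemma poly_ring_on_simps [simp]:
  "p \<otimes>\<^bsub>poly_ring_on V\<^esub> q = p * q" "p \<oplus>\<^bsub>poly_ring_on V\<^esub> q = p + q"
  "\<one>\<^bsub>poly_ring_on V\<^esub> = 1" "\<zero>\<^bsub>poly_ring_on V\<^esub> = 0"
  "p \<in> carrier (poly_ring_on V) \<longleftrightarrow> (\<forall>e\<in>Poly_Mapping.keys p. Poly_Mapping.keys e \<subseteq> V)"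
  by (simp_all add: poly_ring_on_def)

text \<open>\<open>a_inv\<close> is derived from the additive monoid of the ring record, so
  uniqueness of inverses is what identifies it with negation of polynomials.\<close>

lemma poly_ring_on_a_inv:
  assumes "p \<in> carrier (poly_ring_on V :: ('v, 'k::field) mpoly ring)"
  shows "\<ominus>\<^bsub>poly_ring_on V\<^esub> p = - p"
proof -
  interpret cring "poly_ring_on V :: ('v, 'k) mpoly ring" by (rule poly_ring_on_cring)
  show ?thesis
    by (rule minus_equality) (use assms in simp_all)
qed

text \<open>In exponents, \<open>e = a + c\<close> is divisibility of monomials. Every monomial of a
  product is a product of monomials of the factors, so divisibility by some \<open>a\<close> in
  \<open>A\<close> survives multiplication by ring elements. The set serves as an upper bound for
  the ideal generated by the monomials with exponents in \<open>A\<close>.\<close>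

lemma ideal_monomial_multiples:
  "ideal {p \<in> carrier (poly_ring_on V). \<forall>e\<in>Poly_Mapping.keys p. \<exists>a\<in>A. \<exists>c. e = a + c}
     (poly_ring_on V :: ('v, 'k::field) mpoly ring)"
  (is "ideal ?J ?R")
proof -
  interpret cring ?R by (rule poly_ring_on_cring)
  have mult: "x * p \<in> ?J" if p: "p \<in> ?J" and x: "x \<in> carrier ?R" for p x
  proof -
    have "\<exists>a\<in>A. \<exists>c. e = a + c" if "e \<in> Poly_Mapping.keys (x * p)" for e
    proof -
      obtain f g where "f \<in> Poly_Mapping.keys x" "g \<in> Poly_Mapping.keys p" "e = f + g"
        using \<open>e \<in> Poly_Mapping.keys (x * p)\<close> keys_mult[of x p] by blast
      moreover from p \<open>g \<in> Poly_Mapping.keys p\<close> obtain a c where "a \<in> A" "g = a + c" by blast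
      ultimately have "a \<in> A" "e = a + (f + c)" by (simp_all add: ac_simps)
      then show ?thesis by blast
    qed
    moreover have "x * p \<in> carrier ?R"
      using m_closed[OF x, of p] p by simp
    ultimately show ?thesis by simp
  qed
  have add: "p + q \<in> ?J" if "p \<in> ?J" "q \<in> ?J" for p q
  proof -
    have "p \<in> carrier ?R" "q \<in> carrier ?R" using that by blast+
    then have "p + q \<in> carrier ?R" using a_closed[of p q] by simp
    moreover have "\<exists>a\<in>A. \<exists>c. e = a + c" if "e \<in> Poly_Mapping.keys (p + q)" for e
      using that \<open>p \<in> ?J\<close> \<open>q \<in> ?J\<close> keys_add[of p q] by blast
    ultimately show ?thesis by blast
  qed
  show ?thesis
  proof (rule idealI)
    show "ring ?R" by (rule ring_axioms)
    show "subgroup ?J (add_monoid ?R)"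
    proof
      show "?J \<subseteq> carrier (add_monoid ?R)" by auto
    next
      show "p \<otimes>\<^bsub>add_monoid ?R\<^esub> q \<in> ?J" if "p \<in> ?J" "q \<in> ?J" for p q
        using add[OF that] by (simp only: poly_ring_on_simps monoid.simps)
    next
      fix p assume "p \<in> ?J"
      then show "inv\<^bsub>add_monoid ?R\<^esub> p \<in> ?J"
        using poly_ring_on_a_inv[of p V] by (simp add: a_inv_def)
    qed simp_all
    show "x \<otimes>\<^bsub>?R\<^esub> p \<in> ?J" if "p \<in> ?J" "x \<in> carrier ?R" for p x
      unfolding poly_ring_on_simps(1) using that by (rule mult)
    show "p \<otimes>\<^bsub>?R\<^esub> x \<in> ?J" if "p \<in> ?J" "x \<in> carrier ?R" for p x
      unfolding poly_ring_on_simps(1) mult.commute[of p x] using that by (rule mult)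
  qed
qed

text \<open>From left to right, the generated ideal lies inside the ideal of
  \<open>ideal_monomial_multiples\<close>, and \<open>e\<close> is the only key of
  \<open>mono_poly e\<close>. From right to left, a generator is multiplied by the monomial with
  exponent \<open>c\<close>.\<close>

lemma mono_poly_in_genideal_iff:
  assumes A: "\<And>a. a \<in> A \<Longrightarrow> Poly_Mapping.keys a \<subseteq> V" and e: "Poly_Mapping.keys e \<subseteq> V"
  shows "mono_poly e \<in> Idl\<^bsub>poly_ring_on V :: ('v, 'k::field) mpoly ring\<^esub> (mono_poly ` A)
           \<longleftrightarrow> (\<exists>a\<in>A. \<exists>c. e = a + c)"
    (is "_ \<in> genideal ?R ?S \<longleftrightarrow> _")
proof
  interpret cring ?R by (rule poly_ring_on_cring)
  assume "mono_poly e \<in> Idl\<^bsub>?R\<^esub> ?S"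
  moreover have "Idl\<^bsub>?R\<^esub> ?S \<subseteq>
      {p \<in> carrier ?R. \<forall>e\<in>Poly_Mapping.keys p. \<exists>a\<in>A. \<exists>c. e = a + c}"
    by (rule genideal_minimal[OF ideal_monomial_multiples])
       (use A in \<open>fastforce intro: exI[of _ 0]\<close>)
  ultimately show "\<exists>a\<in>A. \<exists>c. e = a + c" by auto
next
  interpret cring ?R by (rule poly_ring_on_cring)
  assume "\<exists>a\<in>A. \<exists>c. e = a + c"
  then obtain a c where a: "a \<in> A" and eq: "e = a + c" by blast
  have sub: "?S \<subseteq> carrier ?R" using A by auto
  interpret I: ideal "Idl\<^bsub>?R\<^esub> ?S" ?R by (rule genideal_ideal[OF sub])
  have "mono_poly a \<in> Idl\<^bsub>?R\<^esub> ?S" using genideal_self[OF sub] a by auto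
  \<comment> \<open>Exponents are natural numbers, so nothing cancels in \<open>a + c\<close> and
    the support of \<open>c\<close> stays inside that of \<open>e\<close>; hence the cofactor
    belongs to the ring.\<close>
  moreover have "Poly_Mapping.keys c \<subseteq> V"
    using e eq by (auto simp: in_keys_iff lookup_add)
  then have "mono_poly c \<in> carrier ?R" by simp
  ultimately have "mono_poly c \<otimes>\<^bsub>?R\<^esub> mono_poly a \<in> Idl\<^bsub>?R\<^esub> ?S" by (rule I.I_l_closed)
  then show "mono_poly e \<in> Idl\<^bsub>?R\<^esub> ?S" by (simp add: mult_single eq add.commute)
qed

text \<open>When no generator properly divides another, the set of generators is contained in every
  set of monomials generating the same ideal. Being the least such set, it is irredundant, and any
  other irredundant one contains it and so equals it. This resolves the definite description in
  \<open>min_monomial_gens\<close>.\<close>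

lemma min_monomial_gens_antichain:
  assumes A: "\<And>a. a \<in> A \<Longrightarrow> Poly_Mapping.keys a \<subseteq> V"
    and antichain: "\<And>a c. a \<in> A \<Longrightarrow> a + c \<in> A \<Longrightarrow> c = 0"
  shows "min_monomial_gens V (Idl\<^bsub>poly_ring_on V :: ('v, 'k::field) mpoly ring\<^esub> (mono_poly ` A))
           = mono_poly ` A"
    (is "_ (genideal ?R ?S) = _")
proof -
  interpret cring ?R by (rule poly_ring_on_cring)
  (* Each generator a is a multiple of some b with monomial in T, which in turn is a multiple of a
     generator; the antichain condition forces a = b. *)
  have sub_of_gen: "?S \<subseteq> T" if T: "T \<subseteq> monomials_on V" "Idl\<^bsub>?R\<^esub> T = Idl\<^bsub>?R\<^esub> ?S" for T
  proof -
    define B where "B = {e. mono_poly e \<in> T}"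
    have TB: "T = mono_poly ` B"
      using T(1) unfolding B_def monomials_on_def by auto
    have BV: "Poly_Mapping.keys b \<subseteq> V" if "b \<in> B" for b
    proof -
      have "(mono_poly b :: ('v, 'k) mpoly) \<in> monomials_on V" using that T(1) B_def by auto
      then show ?thesis by (auto simp: monomials_on_def dest!: arg_cong[where f = Poly_Mapping.keys])
    qed
    have "a \<in> B" if a: "a \<in> A" for a
    proof -
      have "mono_poly a \<in> Idl\<^bsub>?R\<^esub> (mono_poly ` B)"
        using T(2) TB mono_poly_in_genideal_iff[of A V a, where 'k = 'k] A a
        by (metis add.right_neutral)
      then obtain b c where b: "b \<in> B" and ab: "a = b + c"
        using mono_poly_in_genideal_iff[of B V a, where 'k = 'k] A a BV by auto
      have "mono_poly b \<in> Idl\<^bsub>?R\<^esub> ?S"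
        using T(2) TB mono_poly_in_genideal_iff[of B V b, where 'k = 'k] BV b
        by (metis add.right_neutral)
      then obtain a' d where a': "a' \<in> A" and ba: "b = a' + d"
        using mono_poly_in_genideal_iff[of A V b, where 'k = 'k] A BV b by auto
      have "a' + (d + c) \<in> A" using a ab ba by (simp add: add.assoc)
      then have "d + c = 0" using antichain a' by blast
      \<comment> \<open>Coordinatewise, a sum of natural numbers vanishes only if both summands
        do.\<close>
      then have "c = 0"
        by (intro poly_mapping_eqI) (metis add_is_0 lookup_add lookup_zero)
      then show ?thesis using b ab by simp
    qed
    then show ?thesis unfolding TB by blast
  qed
  have mon: "?S \<subseteq> monomials_on V"
    using A by (auto simp: monomials_on_def)
  show ?thesis
    unfolding min_monomial_gens_def
  proof (rule the_equality)
    have "Idl\<^bsub>?R\<^esub> T \<noteq> Idl\<^bsub>?R\<^esub> ?S" if "T \<subset> ?S" for T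
      using sub_of_gen[of T] that mon by blast
    then show "?S \<subseteq> monomials_on V \<and> Idl\<^bsub>?R\<^esub> ?S = Idl\<^bsub>?R\<^esub> ?S \<and>
        (\<forall>T. T \<subset> ?S \<longrightarrow> Idl\<^bsub>?R\<^esub> T \<noteq> Idl\<^bsub>?R\<^esub> ?S)"
      using mon by blast
  next
    fix T
    assume T: "T \<subseteq> monomials_on V \<and> Idl\<^bsub>?R\<^esub> T = Idl\<^bsub>?R\<^esub> ?S \<and>
        (\<forall>T'. T' \<subset> T \<longrightarrow> Idl\<^bsub>?R\<^esub> T' \<noteq> Idl\<^bsub>?R\<^esub> ?S)"
    then have "?S \<subseteq> T" by (intro sub_of_gen) auto
    then show "T = ?S" using T by blast
  qed
qed

section \<open>Square-free monomials as finite sets of variables\<close>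

definition ind_exp :: "'v set \<Rightarrow> 'v \<Rightarrow>\<^sub>0 nat" where
  "ind_exp F = (\<Sum>v\<in>F. Poly_Mapping.single v 1)"

text \<open>For infinite \<open>F\<close> the default values agree: the product is 1, the sum of
  exponents is 0, and \<open>mono_poly 0\<close> is 1.\<close>

lemma sqfree_monomial_eq: "sqfree_monomial F = mono_poly (ind_exp F)"
proof (induction F rule: infinite_finite_induct)
  case (insert v F)
  then show ?case by (simp add: sqfree_monomial_def ind_exp_def var_def mult_single)
qed (simp_all add: sqfree_monomial_def ind_exp_def)

lemma lookup_ind_exp:
  assumes "finite F"
  shows "Poly_Mapping.lookup (ind_exp F) v = (if v \<in> F then 1 else 0)"
  using assms by (simp add: ind_exp_def lookup_sum lookup_single when_def)

lemma keys_ind_exp: "finite F \<Longrightarrow> Poly_Mapping.keys (ind_exp F) = F"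
  by (auto simp: in_keys_iff lookup_ind_exp split: if_splits)

lemma keys_ind_exp_subset:
  assumes "finite V" "\<F> \<subseteq> Pow V" "a \<in> ind_exp ` \<F>"
  shows "Poly_Mapping.keys a \<subseteq> V"
proof -
  from assms(3) obtain F where "F \<in> \<F>" and a: "a = ind_exp F" by blast
  then have "F \<subseteq> V" using assms(2) by blast
  then show ?thesis using assms(1) by (simp add: a keys_ind_exp finite_subset)
qed

text \<open>The quotient of the two monomials is the one of \<open>H - F\<close>; conversely, adding
  natural exponents cannot shrink the support.\<close>

lemma ind_exp_dvd_iff:
  assumes "finite F" "finite H"
  shows "(\<exists>c. ind_exp H = ind_exp F + c) \<longleftrightarrow> F \<subseteq> H"
proof
  assume "F \<subseteq> H"
  then have "ind_exp H = ind_exp F + ind_exp (H - F)"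
    using assms by (simp add: ind_exp_def sum.subset_diff add.commute)
  then show "\<exists>c. ind_exp H = ind_exp F + c" by blast
next
  assume "\<exists>c. ind_exp H = ind_exp F + c"
  then obtain c where "ind_exp H = ind_exp F + c" by blast
  then have "Poly_Mapping.keys (ind_exp F) \<subseteq> Poly_Mapping.keys (ind_exp H)"
    by (auto simp: in_keys_iff lookup_add)
  then show "F \<subseteq> H" using assms by (simp add: keys_ind_exp)
qed

lemma sqfree_monomial_inj:
  assumes "finite F" "finite H" "(sqfree_monomial F :: ('v, 'k::field) mpoly) = sqfree_monomial H"
  shows "F = H"
proof -
  have "ind_exp F = ind_exp H"
    using arg_cong[OF assms(3), of Poly_Mapping.keys] by (simp add: sqfree_monomial_eq)
  then show ?thesis using assms(1,2) by (metis keys_ind_exp)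
qed

text \<open>A square-free monomial lies in the ideal exactly if some generator divides it, and
  divisibility is inclusion of supports.\<close>

lemma nonface_complex_genideal:
  assumes "finite V" "\<F> \<subseteq> Pow V"
  shows "nonface_complex V (Idl\<^bsub>poly_ring_on V :: ('v, 'k::field) mpoly ring\<^esub> (sqfree_monomial ` \<F>))
           = {F. F \<subseteq> V \<and> (\<forall>H\<in>\<F>. \<not> H \<subseteq> F)}"
proof -
  have fin: "finite F" if "F \<subseteq> V" for F using that assms(1) by (rule finite_subset)
  have "sqfree_monomial F \<in> Idl\<^bsub>poly_ring_on V :: ('v, 'k) mpoly ring\<^esub> (sqfree_monomial ` \<F>)
          \<longleftrightarrow> (\<exists>H\<in>\<F>. H \<subseteq> F)" if F: "F \<subseteq> V" for F
  proof -
    have "sqfree_monomial F \<in> Idl\<^bsub>poly_ring_on V :: ('v, 'k) mpoly ring\<^esub> (sqfree_monomial ` \<F>)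
          \<longleftrightarrow> (\<exists>a\<in>ind_exp ` \<F>. \<exists>c. ind_exp F = a + c)"
      using mono_poly_in_genideal_iff[of "ind_exp ` \<F>" V "ind_exp F", where 'k = 'k]
        keys_ind_exp_subset[OF assms] F
      by (simp add: sqfree_monomial_eq[abs_def] image_image keys_ind_exp fin)
    also have "\<dots> \<longleftrightarrow> (\<exists>H\<in>\<F>. H \<subseteq> F)"
    proof -
      have "(\<exists>c. ind_exp F = ind_exp H + c) \<longleftrightarrow> H \<subseteq> F" if "H \<in> \<F>" for H
        using that assms(2) by (intro ind_exp_dvd_iff fin F) blast
      then show ?thesis by (simp add: bex_simps cong: bex_cong)
    qed
    finally show ?thesis .
  qed
  then show ?thesis by (auto simp: nonface_complex_def)
qed

text \<open>Through \<open>ind_exp_dvd_iff\<close>, an antichain of sets becomes an antichain of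
  exponents under divisibility, so the given generators are the minimal ones.\<close>

lemma facet_complex_genideal:
  assumes "finite V" "\<F> \<subseteq> Pow V"
    and antichain: "\<And>F H. F \<in> \<F> \<Longrightarrow> H \<in> \<F> \<Longrightarrow> F \<subseteq> H \<Longrightarrow> F = H"
  shows "facet_complex V (Idl\<^bsub>poly_ring_on V :: ('v, 'k::field) mpoly ring\<^esub> (sqfree_monomial ` \<F>))
           = {A. \<exists>F\<in>\<F>. A \<subseteq> F}"
proof -
  have fin: "finite F" if "F \<subseteq> V" for F using that assms(1) by (rule finite_subset)
  have "min_monomial_gens V (Idl\<^bsub>poly_ring_on V :: ('v, 'k) mpoly ring\<^esub> (mono_poly ` ind_exp ` \<F>))
          = mono_poly ` ind_exp ` \<F>"
  proof (rule min_monomial_gens_antichain)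
    fix a c assume "a \<in> ind_exp ` \<F>" "a + c \<in> ind_exp ` \<F>"
    then obtain F H where FH: "F \<in> \<F>" "H \<in> \<F>" "a = ind_exp F" "a + c = ind_exp H" by blast
    then have "F = H"
      using antichain[of F H] ind_exp_dvd_iff[OF fin fin, of F H] assms(2) by (metis PowD subsetD)
    then show "c = 0" using FH by simp
  qed (rule keys_ind_exp_subset[OF assms(1,2)])
  then have gens: "min_monomial_gens V (Idl\<^bsub>poly_ring_on V :: ('v, 'k) mpoly ring\<^esub> (sqfree_monomial ` \<F>))
          = sqfree_monomial ` \<F>"
    by (simp add: sqfree_monomial_eq[abs_def] image_image)
  \<comment> \<open>\<open>facet_complex\<close> selects sets by their monomials; injectivity on
    finite sets leads back from the monomial to a member of the family.\<close>
  have "F \<in> \<F>" if "F \<subseteq> V" "(sqfree_monomial F :: ('v, 'k) mpoly) \<in> sqfree_monomial ` \<F>" for F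
  proof -
    from that(2) obtain H where "H \<in> \<F>" "(sqfree_monomial F :: ('v, 'k) mpoly) = sqfree_monomial H"
      by blast
    moreover from this have "H \<subseteq> V" using assms(2) by blast
    ultimately show ?thesis using sqfree_monomial_inj[OF fin fin] that(1) by metis
  qed
  then show ?thesis
    using assms(2) unfolding facet_complex_def gens by blast
qed

section \<open>f-vectors of edge ideals\<close>

text \<open>For a nonempty complex the shifts by one in \<open>complex_dim\<close> and
  \<open>f_vector\<close> cancel, so the length is the largest cardinality of a face. The void
  complex has an f-vector of length 0 and no face at all, so both sides fail.\<close>

lemma length_f_vector_eq_2_iff:
  assumes "finite \<Delta>"
  shows "length (f_vector \<Delta>) = 2 \<longleftrightarrow> (\<forall>F\<in>\<Delta>. card F \<le> 2) \<and> (\<exists>F\<in>\<Delta>. card F = 2)"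
proof (cases "\<Delta> = {}")
  case False
  then have "length (f_vector \<Delta>) = Max (card ` \<Delta>)"
    by (simp add: f_vector_def complex_dim_def)
  moreover have "Max (card ` \<Delta>) = 2 \<longleftrightarrow> 2 \<in> card ` \<Delta> \<and> (\<forall>k\<in>card ` \<Delta>. k \<le> 2)"
    using assms False by (intro Max_eq_iff) auto
  ultimately show ?thesis by auto
qed (simp add: f_vector_def complex_dim_def)

lemma f_vector_length_2:
  assumes "length (f_vector \<Delta>) = 2"
  shows "f_vector \<Delta> = [int (card {F \<in> \<Delta>. card F = 1}), int (card {F \<in> \<Delta>. card F = 2})]"
proof -
  have "nat (complex_dim \<Delta> + 1) = 2" using assms by (simp add: f_vector_def)
  then show ?thesis by (simp add: f_vector_def numeral_2_eq_2)
qed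

lemma quasi_f_ideal_length_2_iff:
  assumes "sqfree_monomial_ideal V I" "finite (nonface_complex V I)" "finite (facet_complex V I)"
  shows "quasi_f_ideal V I [a, b] \<longleftrightarrow>
    (\<forall>F\<in>nonface_complex V I. card F \<le> 2) \<and> (\<exists>F\<in>nonface_complex V I. card F = 2) \<and>
    (\<forall>F\<in>facet_complex V I. card F \<le> 2) \<and> (\<exists>F\<in>facet_complex V I. card F = 2) \<and>
    int (card {F \<in> nonface_complex V I. card F = 1})
      - int (card {F \<in> facet_complex V I. card F = 1}) = a \<and>
    int (card {F \<in> nonface_complex V I. card F = 2})
      - int (card {F \<in> facet_complex V I. card F = 2}) = b"
proof -
  have "quasi_f_ideal V I [a, b] \<longleftrightarrow>
    length (f_vector (nonface_complex V I)) = 2 \<and> length (f_vector (facet_complex V I)) = 2 \<and>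
    map2 (-) (f_vector (nonface_complex V I)) (f_vector (facet_complex V I)) = [a, b]"
    using assms(1) by (simp add: quasi_f_ideal_def numeral_2_eq_2)
  also have "\<dots> \<longleftrightarrow>
    length (f_vector (nonface_complex V I)) = 2 \<and> length (f_vector (facet_complex V I)) = 2 \<and>
    int (card {F \<in> nonface_complex V I. card F = 1})
      - int (card {F \<in> facet_complex V I. card F = 1}) = a \<and>
    int (card {F \<in> nonface_complex V I. card F = 2})
      - int (card {F \<in> facet_complex V I. card F = 2}) = b"
    \<comment> \<open>The congruence rules make both length conditions available as assumptions,
      under which each f-vector is an explicit two-entry list.\<close>
    by (rule conj_cong[OF refl], rule conj_cong[OF refl]) (simp add: f_vector_length_2)
  finally show ?thesis
    by (simp only: length_f_vector_eq_2_iff assms(2,3) conj_assoc)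
qed

text \<open>Opposite arcs yield the same two-element set, so the cardinality counts undirected
  edges.\<close>

definition edge_sets :: "'v pair_pre_digraph \<Rightarrow> 'v set set" where
  "edge_sets G = {{u, v} | u v. (u, v) \<in> parcs G}"

text \<open>These are the edges of the complementary graph, that is, the independent sets of size
  two.\<close>

definition nonedge_sets :: "'v pair_pre_digraph \<Rightarrow> 'v set set" where
  "nonedge_sets G = {F. F \<subseteq> pverts G \<and> card F = 2 \<and> F \<notin> edge_sets G}"

section \<open>From type (0, b) to counting edges and non-edges\<close>

context pair_graph
begin

lemma arc_neq: "(u, v) \<in> parcs G \<Longrightarrow> u \<noteq> v"
  using pair_no_loops[of "(u, v)"] by simp

lemma arc_sym: "(u, v) \<in> parcs G \<Longrightarrow> (v, u) \<in> parcs G"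
  using pair_sym_arcs by (simp add: symmetric_def sym_def)

lemma edge_sets_subset: "edge_sets G \<subseteq> Pow (pverts G)"
  by (auto simp: edge_sets_def dest: in_arcsD1 in_arcsD2)

lemma card_edge_set: "F \<in> edge_sets G \<Longrightarrow> card F = 2"
  by (auto simp: edge_sets_def dest: arc_neq)

lemma edge_set_iff: "{u, v} \<in> edge_sets G \<longleftrightarrow> (u, v) \<in> parcs G"
  by (auto simp: edge_sets_def doubleton_eq_iff dest: arc_sym)

lemma edge_set_subset_eq:
  assumes "H \<in> edge_sets G" "H \<subseteq> F" "card F = 2"
  shows "H = F"
  using assms card_edge_set by (metis card.infinite card_subset_eq zero_neq_numeral)

text \<open>The absence of loops makes each generator square-free.\<close>

lemma edge_ideal_eq:
  "edge_ideal G = Idl\<^bsub>poly_ring_on (pverts G) :: ('a, 'k::field) mpoly ring\<^esub> (sqfree_monomial ` edge_sets G)"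
proof -
  have "sqfree_monomial {u, v} = (var u * var v :: ('a, 'k) mpoly)" if "(u, v) \<in> parcs G" for u v
    using arc_neq[OF that] by (simp add: sqfree_monomial_def)
  then have "{var u * var v | u v. (u, v) \<in> parcs G} =
      (sqfree_monomial ` edge_sets G :: ('a, 'k) mpoly set)"
    unfolding edge_sets_def by (auto simp: image_iff) metis+
  then show ?thesis by (simp add: edge_ideal_def)
qed

text \<open>This removes all algebra. Only the non-face complex imposes a bound on face sizes, since
  every face of the facet complex lies in an edge; the two existence conditions on faces of size two
  become the existence of an edge and of a non-edge.\<close>

lemma quasi_f_graph_iff:
  assumes "no_isolated_vertices G"
  shows "quasi_f_graph TYPE('k::field) G [0, b] \<longleftrightarrow>
    (\<forall>F\<subseteq>pverts G. (\<forall>H\<in>edge_sets G. \<not> H \<subseteq> F) \<longrightarrow> card F \<le> 2) \<and>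
    edge_sets G \<noteq> {} \<and> nonedge_sets G \<noteq> {} \<and>
    int (card (nonedge_sets G)) - int (card (edge_sets G)) = b"
proof -
  define I :: "('a, 'k) mpoly set" where "I = edge_ideal G"
  define N where "N = nonface_complex (pverts G) I"
  define D where "D = facet_complex (pverts G) I"
  have sq: "sqfree_monomial_ideal (pverts G) I"
    unfolding I_def edge_ideal_eq sqfree_monomial_ideal_def using edge_sets_subset by blast
  have N: "N = {F. F \<subseteq> pverts G \<and> (\<forall>H\<in>edge_sets G. \<not> H \<subseteq> F)}"
    unfolding N_def I_def edge_ideal_eq
    by (rule nonface_complex_genideal[OF pair_finite_verts edge_sets_subset])
  have D: "D = {A. \<exists>F\<in>edge_sets G. A \<subseteq> F}"
    unfolding D_def I_def edge_ideal_eq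
    by (rule facet_complex_genideal[OF pair_finite_verts edge_sets_subset])
       (use edge_set_subset_eq card_edge_set in blast)
  have finE: "finite F" if "F \<in> edge_sets G" for F
    using card_edge_set[OF that] card.infinite by fastforce
  have "N \<subseteq> Pow (pverts G)" "D \<subseteq> Pow (pverts G)"
    using edge_sets_subset unfolding N D by blast+
  then have fin: "finite N" "finite D"
    using pair_finite_verts by (auto intro: finite_subset)
  \<comment> \<open>An edge has two elements and cannot fit into a singleton, so every vertex is a
    non-face.\<close>
  have N1: "{F \<in> N. card F = 1} = (\<lambda>v. {v}) ` pverts G"
  proof -
    have "\<not> H \<subseteq> {v}" if "H \<in> edge_sets G" for H v
      using card_edge_set[OF that] card_mono[of "{v}" H] by auto
    then show ?thesis unfolding N by (auto simp: card_1_singleton_iff)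
  qed
  \<comment> \<open>Every vertex lies on an edge because none is isolated. Together with
    \<open>N1\<close> this makes the first entry of the type 0.\<close>
  have D1: "{F \<in> D. card F = 1} = (\<lambda>v. {v}) ` pverts G"
  proof -
    have "(\<exists>F\<in>edge_sets G. {v} \<subseteq> F) \<longleftrightarrow> v \<in> pverts G" for v
      using assms edge_sets_subset unfolding no_isolated_vertices_def
      by (metis (no_types, lifting) PowD edge_set_iff insert_iff insert_subset subset_iff)
    then show ?thesis unfolding D by (auto simp: card_1_singleton_iff image_iff)
  qed
  have N2: "{F \<in> N. card F = 2} = nonedge_sets G"
    unfolding N nonedge_sets_def using edge_set_subset_eq by blast
  have D2: "{F \<in> D. card F = 2} = edge_sets G"
  proof -
    have "F = A" if "F \<in> edge_sets G" "A \<subseteq> F" "card A = 2" for A F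
      using card_subset_eq[OF finE, of F A] that card_edge_set by simp
    then show ?thesis unfolding D using card_edge_set by blast
  qed
  have N2': "(\<exists>F\<in>N. card F = 2) \<longleftrightarrow> nonedge_sets G \<noteq> {}" unfolding N2[symmetric] by blast
  have D2': "(\<exists>F\<in>D. card F = 2) \<longleftrightarrow> edge_sets G \<noteq> {}" unfolding D2[symmetric] by blast
  have D_le: "\<forall>F\<in>D. card F \<le> 2"
    using card_mono[OF finE] card_edge_set unfolding D by fastforce
  have "quasi_f_graph TYPE('k) G [0, b] \<longleftrightarrow>
    (\<forall>F\<in>N. card F \<le> 2) \<and> edge_sets G \<noteq> {} \<and> nonedge_sets G \<noteq> {} \<and>
    int (card (nonedge_sets G)) - int (card (edge_sets G)) = b"
    unfolding quasi_f_graph_def I_def[symmetric]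
      quasi_f_ideal_length_2_iff[OF sq fin[unfolded N_def D_def]]
      N_def[symmetric] D_def[symmetric] N1 D1 N2 D2 N2' D2'
    using D_le by auto
  also have "(\<forall>F\<in>N. card F \<le> 2) \<longleftrightarrow>
      (\<forall>F\<subseteq>pverts G. (\<forall>H\<in>edge_sets G. \<not> H \<subseteq> F) \<longrightarrow> card F \<le> 2)"
    unfolding N by blast
  finally show ?thesis .
qed

end

section \<open>Disjoint unions of two cliques\<close>

context pair_graph
begin

text \<open>For a fixed partition of the vertices, each ordered pair can be treated separately:
  complementation exchanges the pairs of distinct vertices inside a part with the pairs
  across.\<close>

lemma mn_graph_iff:
  "mn_graph m n G \<longleftrightarrow> m > 0 \<and> n > 0 \<and>
     (\<exists>U W. pverts G = U \<union> W \<and> U \<inter> W = {} \<and> card U = m \<and> card W = n \<and>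
       (\<forall>u v. (u, v) \<in> parcs G \<longleftrightarrow> u \<noteq> v \<and> (u \<in> U \<and> v \<in> U \<or> u \<in> W \<and> v \<in> W)))"
proof -
  have "parcs (complement_graph G) = U \<times> W \<union> W \<times> U \<longleftrightarrow>
      (\<forall>u v. (u, v) \<in> parcs G \<longleftrightarrow> u \<noteq> v \<and> (u \<in> U \<and> v \<in> U \<or> u \<in> W \<and> v \<in> W))"
    (is "?L \<longleftrightarrow> ?R") if V: "pverts G = U \<union> W" "U \<inter> W = {}" for U W
  proof -
    have "?L \<longleftrightarrow> (\<forall>u v. (u \<in> U \<union> W \<and> v \<in> U \<union> W \<and> u \<noteq> v \<and> (u, v) \<notin> parcs G) \<longleftrightarrow>
        u \<in> U \<and> v \<in> W \<or> u \<in> W \<and> v \<in> U)"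
      unfolding complement_graph_def V(1) by (simp add: set_eq_iff)
    also have "\<dots> \<longleftrightarrow> ?R"
    proof (intro iff_allI)
      fix u v
      \<comment> \<open>The complement determines \<open>G\<close> only on pairs of distinct
        vertices; on all other pairs \<open>G\<close> has no arc by well-formedness and the absence
        of loops.\<close>
      have "(u, v) \<in> parcs G \<Longrightarrow> u \<noteq> v \<and> u \<in> U \<union> W \<and> v \<in> U \<union> W"
        using arc_neq in_arcsD1 in_arcsD2 V(1) by metis
      then show "((u \<in> U \<union> W \<and> v \<in> U \<union> W \<and> u \<noteq> v \<and> (u, v) \<notin> parcs G) \<longleftrightarrow>
          u \<in> U \<and> v \<in> W \<or> u \<in> W \<and> v \<in> U) \<longleftrightarrow>
          ((u, v) \<in> parcs G \<longleftrightarrow> u \<noteq> v \<and> (u \<in> U \<and> v \<in> U \<or> u \<in> W \<and> v \<in> W))"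
        using V(2) by blast
    qed
    finally show ?thesis .
  qed
  then have eq: "pverts G = U \<union> W \<and> U \<inter> W = {} \<and> card U = m \<and> card W = n \<and>
        parcs (complement_graph G) = U \<times> W \<union> W \<times> U \<longleftrightarrow>
      pverts G = U \<union> W \<and> U \<inter> W = {} \<and> card U = m \<and> card W = n \<and>
        (\<forall>u v. (u, v) \<in> parcs G \<longleftrightarrow> u \<noteq> v \<and> (u \<in> U \<and> v \<in> U \<or> u \<in> W \<and> v \<in> W))" for U W
    by (intro conj_cong refl)
  have "pverts (complement_graph G) = pverts G" by (simp add: complement_graph_def)
  then show ?thesis
    unfolding mn_graph_def complete_bipartite_digraph_pair_def
    by (simp only: eq pair_finite_verts simp_thms)
qed

text \<open>Connectedness means strong connectedness of the symmetric closure, and the arcs of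
  \<open>G\<close> are already symmetric.\<close>

lemma connected_iff_strongly_connected:
  "Digraph_Component.connected (with_proj G) \<longleftrightarrow> strongly_connected (with_proj G)"
proof -
  have "parcs (mk_symmetric (with_proj G)) = parcs G"
    by (auto simp: mk_symmetric_def intro: arc_sym)
  then have "mk_symmetric (with_proj G) = G" by (simp add: mk_symmetric_def)
  then show ?thesis by (simp add: Digraph_Component.connected_def)
qed

text \<open>\<open>U\<close> is the component of some vertex \<open>a\<close>, and \<open>W\<close>
  collects all remaining vertices. Nothing is known about connections inside \<open>W\<close>
  beforehand; the argument with independent triples makes it a clique just like
  \<open>U\<close>.\<close>

lemma disconnected_two_cliques:
  assumes nonempty: "pverts G \<noteq> {}"
    and disconnected: "\<not> Digraph_Component.connected (with_proj G)"
    and indep: "\<forall>F\<subseteq>pverts G. (\<forall>H\<in>edge_sets G. \<not> H \<subseteq> F) \<longrightarrow> card F \<le> 2"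
  obtains U W where "pverts G = U \<union> W" "U \<inter> W = {}" "U \<noteq> {}" "W \<noteq> {}"
    "\<And>u v. (u, v) \<in> parcs G \<longleftrightarrow> u \<noteq> v \<and> (u \<in> U \<and> v \<in> U \<or> u \<in> W \<and> v \<in> W)"
proof -
  \<comment> \<open>Strong connectedness also demands a vertex, so nonemptiness turns its failure
    into an unreachable pair.\<close>
  obtain a b where a: "a \<in> pverts G" and b: "b \<in> pverts G" and ab: "\<not> a \<rightarrow>\<^sup>*\<^bsub>with_proj G\<^esub> b"
    using disconnected nonempty
    unfolding connected_iff_strongly_connected strongly_connected_def by auto
  define U where "U = {v. a \<rightarrow>\<^sup>*\<^bsub>with_proj G\<^esub> v}"
  define W where "W = pverts G - U"
  have "U \<subseteq> pverts G" unfolding U_def by (auto dest: reachable_in_verts)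
  then have V: "pverts G = U \<union> W" "U \<inter> W = {}" unfolding W_def by auto
  have aU: "a \<in> U" unfolding U_def using a by simp
  have bW: "b \<in> W" unfolding W_def U_def using b ab by simp
  have closed: "v \<in> U" if "u \<in> U" "(u, v) \<in> parcs G" for u v
  proof -
    have "a \<rightarrow>\<^sup>*\<^bsub>with_proj G\<^esub> u" using that(1) by (simp add: U_def)
    then have "a \<rightarrow>\<^sup>*\<^bsub>with_proj G\<^esub> v" by (rule reachable_adj_trans[OF _ that(2)])
    then show ?thesis by (simp add: U_def)
  qed
  have cross: "(u, w) \<notin> parcs G" "(w, u) \<notin> parcs G" if "u \<in> U" "w \<in> W" for u w
    using closed that arc_sym unfolding W_def by blast+
  have no_triple: "(x, y) \<in> parcs G"
    if "x \<in> pverts G" "y \<in> pverts G" "z \<in> pverts G" "x \<noteq> y" "z \<noteq> x" "z \<noteq> y"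
      "(x, z) \<notin> parcs G" "(y, z) \<notin> parcs G" for x y z
  proof (rule ccontr)
    assume "(x, y) \<notin> parcs G"
    then have "(u, v) \<notin> parcs G" if "u \<in> {x, y, z}" "v \<in> {x, y, z}" for u v
      using that \<open>(x, z) \<notin> parcs G\<close> \<open>(y, z) \<notin> parcs G\<close> arc_sym arc_neq by auto
    then have "\<forall>H\<in>edge_sets G. \<not> H \<subseteq> {x, y, z}"
      by (auto simp: edge_sets_def)
    moreover have "{x, y, z} \<subseteq> pverts G" using that by simp
    ultimately have "card {x, y, z} \<le> 2" using indep by simp
    then show False using that by simp
  qed
  have "(u, v) \<in> parcs G \<longleftrightarrow> u \<noteq> v \<and> (u \<in> U \<and> v \<in> U \<or> u \<in> W \<and> v \<in> W)" for u v
  proof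
    assume uv: "(u, v) \<in> parcs G"
    then have "u \<in> U \<union> W" "v \<in> U \<union> W" using in_arcsD1 in_arcsD2 V(1) by metis+
    then show "u \<noteq> v \<and> (u \<in> U \<and> v \<in> U \<or> u \<in> W \<and> v \<in> W)"
      using uv cross arc_neq by blast
  next
    assume "u \<noteq> v \<and> (u \<in> U \<and> v \<in> U \<or> u \<in> W \<and> v \<in> W)"
    then consider "u \<noteq> v" "u \<in> U" "v \<in> U" | "u \<noteq> v" "u \<in> W" "v \<in> W" by blast
    then show "(u, v) \<in> parcs G"
    proof cases
      \<comment> \<open>The third vertex of the triple comes from the opposite part:
        \<open>b\<close> for two vertices of \<open>U\<close>, and \<open>a\<close> for two vertices
        of \<open>W\<close>.\<close>
      case 1
      then show ?thesis using no_triple[of u v b] bW cross V by blast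
    next
      case 2
      then show ?thesis using no_triple[of u v a] aU cross V by blast
    qed
  qed
  then show ?thesis using that V aU bW by blast
qed

section \<open>Connectivity, independent sets and edge counts of two disjoint cliques\<close>

context
  fixes U W :: "'a set"
  assumes V: "pverts G = U \<union> W" "U \<inter> W = {}"
    and arcs_iff: "\<And>u v. (u, v) \<in> parcs G \<longleftrightarrow> u \<noteq> v \<and> (u \<in> U \<and> v \<in> U \<or> u \<in> W \<and> v \<in> W)"
begin

text \<open>No arc leaves \<open>U\<close>, so a walk starting in \<open>U\<close> never reaches
  \<open>W\<close>.\<close>

lemma two_cliques_disconnected:
  assumes "U \<noteq> {}" "W \<noteq> {}"
  shows "\<not> Digraph_Component.connected (with_proj G)"
proof
  assume "Digraph_Component.connected (with_proj G)"
  moreover obtain u w where u: "u \<in> U" and w: "w \<in> W" using assms by blast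
  ultimately have "u \<rightarrow>\<^sup>*\<^bsub>with_proj G\<^esub> w"
    using V(1) unfolding connected_iff_strongly_connected strongly_connected_def by simp
  then have "w \<in> U"
  proof (induction rule: reachable_induct)
    case (step x y)
    then show ?case using arcs_iff V(2) by auto
  qed (rule u)
  then show False using w V(2) by blast
qed

text \<open>An independent set meets each of the two cliques in at most one vertex.\<close>

lemma two_cliques_independent_card_le:
  assumes F: "F \<subseteq> pverts G" and indep: "\<forall>H\<in>edge_sets G. \<not> H \<subseteq> F"
  shows "card F \<le> 2"
proof -
  have "(x, y) \<notin> parcs G" if "x \<in> F" "y \<in> F" for x y
    using indep that edge_set_iff[of x y] by auto
  then have eq: "x = y" if "x \<in> F" "y \<in> F" "x \<in> U \<and> y \<in> U \<or> x \<in> W \<and> y \<in> W" for x y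
    using that arcs_iff by blast
  have "finite F" using F pair_finite_verts by (rule finite_subset)
  then have "card (F \<inter> U) \<le> 1" "card (F \<inter> W) \<le> 1"
    using eq by (auto simp: card_le_Suc0_iff_eq)
  moreover have "F = (F \<inter> U) \<union> (F \<inter> W)" using F V(1) by blast
  ultimately show ?thesis using card_Un_le[of "F \<inter> U" "F \<inter> W"] by simp
qed

lemma two_cliques_nonedge_sets: "nonedge_sets G = (\<lambda>(u, w). {u, w}) ` (U \<times> W)"
proof (intro Set.set_eqI iffI)
  fix F assume "F \<in> nonedge_sets G"
  then obtain x y where F: "F = {x, y}" "x \<noteq> y" "x \<in> U \<union> W" "y \<in> U \<union> W" "(x, y) \<notin> parcs G"
    unfolding nonedge_sets_def V(1) card_2_iff using edge_set_iff by auto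
  then consider "x \<in> U" "y \<in> W" | "y \<in> U" "x \<in> W" using arcs_iff by blast
  then show "F \<in> (\<lambda>(u, w). {u, w}) ` (U \<times> W)"
  proof cases
    case 1
    then show ?thesis using F(1) by auto
  next
    case 2
    then show ?thesis unfolding F(1) by (intro image_eqI[of _ _ "(y, x)"]) auto
  qed
next
  fix F assume "F \<in> (\<lambda>(u, w). {u, w}) ` (U \<times> W)"
  then obtain u w where F: "F = {u, w}" "u \<in> U" "w \<in> W" by auto
  then have "u \<noteq> w" "(u, w) \<notin> parcs G" using V(2) arcs_iff by blast+
  then show "F \<in> nonedge_sets G"
    using F V(1) by (simp add: nonedge_sets_def edge_set_iff)
qed

lemma two_cliques_card_nonedge_sets: "card (nonedge_sets G) = card U * card W"
proof -
  \<comment> \<open>Disjointness of the parts tells which element of the pair is \<open>u\<close>,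
    so the two cannot be interchanged.\<close>
  have "inj_on (\<lambda>(u, w). {u, w}) (U \<times> W)"
    using V(2) by (auto simp: inj_on_def doubleton_eq_iff)
  then show ?thesis
    unfolding two_cliques_nonedge_sets by (simp add: card_image card_cartesian_product)
qed

text \<open>Let m and n be the sizes of the parts and e the number of edges. Edges and non-edges
  partition the two-element vertex sets, so e + mn is m+n choose 2. Hence 2(mn - e) = 4mn -
  (m+n)(m+n-1) = m + n - (m-n)^2. Doubling avoids division.\<close>

lemma two_cliques_type:
  "2 * (int (card (nonedge_sets G)) - int (card (edge_sets G)))
     = int (card U) + int (card W) - (int (card U) - int (card W))\<^sup>2"
proof -
  have "edge_sets G \<union> nonedge_sets G = {F. F \<subseteq> pverts G \<and> card F = 2}"
    using edge_sets_subset card_edge_set by (auto simp: nonedge_sets_def)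
  moreover have "finite (edge_sets G)" "finite (nonedge_sets G)"
    using pair_finite_verts edge_sets_subset
    by (auto simp: nonedge_sets_def intro: finite_subset[of _ "Pow (pverts G)"])
  moreover have "edge_sets G \<inter> nonedge_sets G = {}" by (auto simp: nonedge_sets_def)
  ultimately have "card (edge_sets G) + card (nonedge_sets G) = card (pverts G) choose 2"
    using n_subsets[OF pair_finite_verts, of 2] card_Un_disjoint by metis
  moreover have "card (pverts G) = card U + card W"
    unfolding V(1) using V pair_finite_verts by (intro card_Un_disjoint) auto
  ultimately have "card (edge_sets G) + card U * card W = (card U + card W) choose 2"
    by (simp add: two_cliques_card_nonedge_sets)
  \<comment> \<open>Stated over the integers, where k - 1 is not truncated at k = 0.\<close>
  moreover have "2 * int (k choose 2) = int k * (int k - 1)" for k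
    by (induction k) (simp_all add: numeral_2_eq_2 algebra_simps)
  ultimately have "2 * (int (card (edge_sets G)) + int (card U) * int (card W))
      = (int (card U) + int (card W)) * (int (card U) + int (card W) - 1)"
    by (metis of_nat_add of_nat_mult)
  then show ?thesis
    unfolding two_cliques_card_nonedge_sets by (simp add: algebra_simps power2_eq_square)
qed

end

end

section \<open>The equivalence between disconnected graphs of type (0, b) and two cliques\<close>

theorem theorem4p2:
  fixes G :: "'v pair_pre_digraph" and b :: int
  assumes "pair_graph G" and "no_isolated_vertices G"
  shows "\<not> Digraph_Component.connected (with_proj G) \<and> quasi_f_graph TYPE('k::field) G [0, b] \<longleftrightarrow>
         (\<exists>m n :: nat. mn_graph m n G \<and> (int m - int n)\<^sup>2 = int m + int n - 2 * b)"
proof -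
  interpret pair_graph G by (rule assms(1))
  note qf = quasi_f_graph_iff[OF assms(2), where 'k = 'k and b = b]
  show ?thesis
  proof
    assume L: "\<not> Digraph_Component.connected (with_proj G) \<and> quasi_f_graph TYPE('k) G [0, b]"
    then have "edge_sets G \<noteq> {}" using qf by blast
    \<comment> \<open>The graph without vertices also counts as disconnected; the existence of an
      edge excludes it.\<close>
    then have ne: "pverts G \<noteq> {}" by (auto simp: edge_sets_def dest: in_arcsD1)
    have indep: "\<forall>F\<subseteq>pverts G. (\<forall>H\<in>edge_sets G. \<not> H \<subseteq> F) \<longrightarrow> card F \<le> 2"
      using L qf by blast
    obtain U W where UW: "pverts G = U \<union> W" "U \<inter> W = {}" "U \<noteq> {}" "W \<noteq> {}"
      "\<And>u v. (u, v) \<in> parcs G \<longleftrightarrow> u \<noteq> v \<and> (u \<in> U \<and> v \<in> U \<or> u \<in> W \<and> v \<in> W)"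
      by (rule disconnected_two_cliques[OF ne conjunct1[OF L] indep]) (rule that)
    have "finite U" "finite W" using pair_finite_verts UW(1) by auto
    then have "card U > 0" "card W > 0" using UW(3,4) by (auto simp: card_gt_0_iff)
    then have "mn_graph (card U) (card W) G"
      unfolding mn_graph_iff using UW by blast
    moreover have "(int (card U) - int (card W))\<^sup>2 = int (card U) + int (card W) - 2 * b"
      using two_cliques_type[OF UW(1,2,5)] L qf by auto
    ultimately show "\<exists>m n. mn_graph m n G \<and> (int m - int n)\<^sup>2 = int m + int n - 2 * b" by blast
  next
    assume "\<exists>m n. mn_graph m n G \<and> (int m - int n)\<^sup>2 = int m + int n - 2 * b"
    then obtain m n where mn: "mn_graph m n G" "(int m - int n)\<^sup>2 = int m + int n - 2 * b" by blast
    then obtain U W where UW: "pverts G = U \<union> W" "U \<inter> W = {}"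
      "\<And>u v. (u, v) \<in> parcs G \<longleftrightarrow> u \<noteq> v \<and> (u \<in> U \<and> v \<in> U \<or> u \<in> W \<and> v \<in> W)"
      and card: "card U = m" "card W = n" "m > 0" "n > 0"
      unfolding mn_graph_iff by blast
    then have ne: "U \<noteq> {}" "W \<noteq> {}" by auto
    \<comment> \<open>Having no isolated vertices supplies the edge demanded by the type; this
      excludes two single vertices, whose edge ideal is zero.\<close>
    then obtain u where "u \<in> pverts G" using UW(1) by blast
    then obtain w where "(u, w) \<in> parcs G" using assms(2) by (auto simp: no_isolated_vertices_def)
    then have "edge_sets G \<noteq> {}" by (auto simp: edge_sets_def)
    moreover have "nonedge_sets G \<noteq> {}"
      using two_cliques_nonedge_sets[OF UW] ne by auto
    moreover have "int (card (nonedge_sets G)) - int (card (edge_sets G)) = b"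
      using two_cliques_type[OF UW] mn(2) card(1,2) by auto
    ultimately have "quasi_f_graph TYPE('k) G [0, b]"
      unfolding qf using two_cliques_independent_card_le[OF UW] by blast
    then show "\<not> Digraph_Component.connected (with_proj G) \<and> quasi_f_graph TYPE('k) G [0, b]"
      using two_cliques_disconnected[OF UW ne] by blast
  qed
qed

end
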